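(* Let $k\ge2$ be an integer, let $T$ be the infinite rooted $k$-ary tree, and let $w$ be a weight on $T$. If there exists some $s>1$ such that $$M_{s}w(x)\lesssim w(x)\qquad\text{for all }x\in T,$$ then for every $1<p<\infty$ and all functions $f$ on $T$ $$\|Mf\|_{L^{p}(w)}\lesssim\|f\|_{L^p(w)}\qquad\text{and}\qquad\|Mf\|_{L^{p'}(\sigma_{p})}\lesssim\|f\|_{L^{p'}(\sigma_{p})},$$ where $\sigma_p=w^{-\frac{1}{p-1}}$ and $p'=\frac{p}{p-1}$.
   Context: For an integer $k\ge2$, $T$ denotes (the vertex set of) the infinite rooted $k$-ary tree, in which every vertex has exactly $k$ children; $d(x,y)$ is the number of edges on the unique path between $x$ and $y$. $|A|$ is the cardinality of $A$ and $B(x,r)=\{y\in T: d(x,y)\le r\}$. The centered maximal function is $Mf(x)=\sup_{r\in\mathbb{N}\cup\{0\}}\frac{1}{|B(x,r)|}\sum_{y\in B(x,r)}|f(y)|$, and $M_sw=\left(M(w^s)\right)^{1/s}$. A weight is a function $w:T\to(0,\infty)$. $\|f\|_{L^q(w)}=\left(\sum_{x\in T}|f(x)|^q w(x)\right)^{1/q}$. The notation $A\lesssim B$ means $A\le CB$ for a finite constant $C$ independent of the varying objects (in the hypothesis: of $x$; in the conclusions: of $f$). *)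

theory Defs
  imports "HOL-Analysis.Analysis"
begin

text \<open>
  A vertex of the rooted \<open>k\<close>-ary tree is the word of child labels \<open>< k\<close> leading to it from the
  root \<open>[]\<close>, most recent label first: the children of \<open>x\<close> are \<open>c # x\<close> for \<open>c < k\<close>.
\<close>

definition tree_verts :: "nat \<Rightarrow> nat list set" where
  "tree_verts k = lists {..<k}"

definition tree_adj :: "nat list \<Rightarrow> nat list \<Rightarrow> bool" where
  "tree_adj x y \<longleftrightarrow> (\<exists>c. y = c # x) \<or> (\<exists>c. x = c # y)"

definition tree_path :: "nat \<Rightarrow> nat list \<Rightarrow> nat list \<Rightarrow> nat list list \<Rightarrow> bool" where
  "tree_path k x y ps \<longleftrightarrow> ps \<noteq> [] \<and> hd ps = x \<and> last ps = y \<and>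
     set ps \<subseteq> tree_verts k \<and> distinct ps \<and> successively tree_adj ps"

text \<open>
  A path is given by its list of vertices, so it has one edge less than its length.
\<close>

definition tree_dist :: "nat \<Rightarrow> nat list \<Rightarrow> nat list \<Rightarrow> nat" where
  "tree_dist k x y = length (THE ps. tree_path k x y ps) - 1"

definition tree_ball :: "nat \<Rightarrow> nat list \<Rightarrow> nat \<Rightarrow> nat list set" where
  "tree_ball k x r = {y \<in> tree_verts k. tree_dist k x y \<le> r}"

text \<open>
  The maximal function and the norms may be infinite, hence take values in \<^typ>\<open>ennreal\<close>.
\<close>

definition maximal :: "nat \<Rightarrow> (nat list \<Rightarrow> real) \<Rightarrow> nat list \<Rightarrow> ennreal" where
  "maximal k f x =
     (SUP r. ennreal (1 / real (card (tree_ball k x r)) * (\<Sum>y\<in>tree_ball k x r. \<bar>f y\<bar>)))"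

text \<open>
  Real power of an extended nonnegative number, meant for exponents \<open>a > 0\<close>.
\<close>

definition ennpowr :: "ennreal \<Rightarrow> real \<Rightarrow> ennreal" where
  "ennpowr u a = (if u = \<infinity> then \<infinity> else ennreal (enn2real u powr a))"

definition maximal_s :: "nat \<Rightarrow> real \<Rightarrow> (nat list \<Rightarrow> real) \<Rightarrow> nat list \<Rightarrow> ennreal" where
  "maximal_s k s w x = ennpowr (maximal k (\<lambda>y. w y powr s) x) (1 / s)"

text \<open>
  The norm is stated for \<^typ>\<open>ennreal\<close>-valued functions so that it applies to the maximal
  function; for a real function \<open>f\<close> it is used with \<open>\<lambda>x. ennreal \<bar>f x\<bar>\<close>.
\<close>

definition Lq_norm :: "nat \<Rightarrow> real \<Rightarrow> (nat list \<Rightarrow> real) \<Rightarrow> (nat list \<Rightarrow> ennreal) \<Rightarrow> ennreal" where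
  "Lq_norm k q w g =
     ennpowr (\<Sum>\<^sub>\<infinity>x\<in>tree_verts k. ennpowr (g x) q * ennreal (w x)) (1 / q)"

end

theory Submission
  imports Defs "HOL-Library.Sublist"
begin

text \<open>
  Call \<open>y\<close> an \<open>(i, j)\<close>-cousin of \<open>x\<close> if going up \<open>i\<close> edges from \<open>x\<close> and \<open>j\<close> edges from \<open>y\<close> leads
  to the same vertex. As \<open>|B(x, r)|\<close> is comparable to \<open>k ^ r\<close>, the maximal function is dominated
  pointwise by the sum over all \<open>i, j\<close> of the operators \<open>A\<^sub>i\<^sub>j\<close> whose kernel is \<open>1 / k ^ (i + j)\<close> on
  pairs of \<open>(i, j)\<close>-cousins, so it suffices that \<open>A\<^sub>i\<^sub>j\<close> decays geometrically in \<open>i\<close> and \<open>j\<close> on the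
  weighted space. A vertex has at most \<open>k ^ j\<close> cousins of type \<open>(i, j)\<close>, so Jensen's inequality
  improves the hypothesis, used as \<open>A\<^sub>i\<^sub>j (w powr s) \<le> C * w powr s\<close>, to \<open>A\<^sub>i\<^sub>j w \<le> C * \<alpha> ^ i * w\<close> with
  \<open>\<alpha> < 1\<close>; this is where \<open>s > 1\<close> enters. One more application of Jensen's inequality gives the
  decay on \<open>L\<^sup>p(w)\<close> (with the kernel as weights) and on the dual space (with the kernel times \<open>w\<close>
  as weights).
\<close>

section \<open>Walks, paths and distance in the tree\<close>

text \<open>The only edge between the subtree under \<open>c # x\<close> and the rest of the tree
  ends in \<open>x\<close>, so a walk cannot leave that subtree without visiting
  \<open>x\<close>.\<close>

lemma walk_stays_below:
  assumes "successively tree_adj ps" "x \<notin> set ps" "ps \<noteq> []" "suffix (c # x) (hd ps)" "v \<in> set ps"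
  shows "suffix (c # x) v"
  using assms
proof (induction ps arbitrary: v)
  case (Cons a ps)
  show ?case
  proof (cases "ps = []")
    case False
    have "suffix (c # x) (hd ps)"
    proof -
      have "tree_adj a (hd ps)" using Cons.prems False by (auto simp: successively_Cons)
      then consider d where "hd ps = d # a" | d where "a = d # hd ps"
        unfolding tree_adj_def by auto
      then show ?thesis
      proof cases
        case 1
        then show ?thesis using Cons.prems by (simp add: suffix_ConsI)
      next
        case 2
        have "hd ps \<noteq> x" using Cons.prems(2) False by (metis hd_in_set list.set_intros(2))
        then show ?thesis using 2 Cons.prems(4) by (auto simp: suffix_Cons)
      qed
    qed
    then show ?thesis using Cons False by (auto simp: successively_Cons)
  qed (use Cons.prems in auto)
qed simp

text \<open>The subtree rooted at \<open>x\<close> can be entered from outside only through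
  \<open>x\<close> itself.\<close>

lemma walk_stays_outside:
  assumes "successively tree_adj ps" "x \<notin> set ps" "ps \<noteq> []" "\<not> suffix x (hd ps)" "v \<in> set ps"
  shows "\<not> suffix x v"
  using assms
proof (induction ps arbitrary: v)
  case (Cons a ps)
  show ?case
  proof (cases "ps = []")
    case False
    have "\<not> suffix x (hd ps)"
    proof -
      have "tree_adj a (hd ps)" using Cons.prems False by (auto simp: successively_Cons)
      then consider d where "hd ps = d # a" | d where "a = d # hd ps"
        unfolding tree_adj_def by auto
      then show ?thesis
      proof cases
        case 1
        have "hd ps \<noteq> x" using Cons.prems(2) False by (metis hd_in_set list.set_intros(2))
        then show ?thesis using 1 Cons.prems(4) by (auto simp: suffix_Cons)
      next
        case 2
        then show ?thesis using Cons.prems(4) by (auto simp: suffix_Cons)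
      qed
    qed
    then show ?thesis using Cons False by (auto simp: successively_Cons)
  qed (use Cons.prems in auto)
qed simp

text \<open>Removing \<open>x\<close> leaves one component for each child of \<open>x\<close> and
  one containing its parent, if any. The common endpoint lies in the component of
  \<open>c # x\<close>, so the second walk must start there as well.\<close>

lemma child_paths_separate:
  assumes "successively tree_adj ps" "x \<notin> set ps" "ps \<noteq> []" "hd ps = c # x"
    and "successively tree_adj qs" "x \<notin> set qs" "qs \<noteq> []" "tree_adj x (hd qs)" "last qs = last ps"
  shows "hd qs = c # x"
proof -
  have *: "suffix (c # x) (last ps)"
    by (rule walk_stays_below[OF assms(1-3)]) (use assms in auto)
  from assms(8) consider d where "hd qs = d # x" | d where "x = d # hd qs"
    unfolding tree_adj_def by auto
  then show ?thesis
  proof cases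
    case 1
    have "suffix (d # x) (last ps)"
      unfolding assms(9)[symmetric]
      by (rule walk_stays_below[OF assms(5-7)]) (use 1 assms(7) in auto)
    with * have "d = c" by (auto simp: suffix_def)
    with 1 show ?thesis by simp
  next
    case 2
    then have "\<not> suffix x (hd qs)" by (metis impossible_Cons suffix_length_le)
    then have "\<not> suffix x (last ps)"
      unfolding assms(9)[symmetric]
      by (rule walk_stays_outside[OF assms(5-7)]) (use assms(7) in auto)
    with * show ?thesis by (meson suffix_ConsD)
  qed
qed

text \<open>Makes the \<open>THE\<close> in \<open>tree_dist\<close> meaningful. After the common
  first vertex both tails avoid it, so their first steps agree: if one step goes to a child, by
  separation of the components, and otherwise because the parent is unique.\<close>

lemma tree_path_unique:
  assumes "ps \<noteq> []" "qs \<noteq> []" "hd ps = hd qs" "last ps = last qs" "distinct ps" "distinct qs"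
    "successively tree_adj ps" "successively tree_adj qs"
  shows "ps = qs"
  using assms
proof (induction ps arbitrary: qs)
  case (Cons x ps)
  obtain qs' where qs: "qs = x # qs'" using Cons.prems by (cases qs) auto
  show ?case
  proof (cases "ps = [] \<or> qs' = []")
    case True
    then show ?thesis using Cons.prems qs by (auto split: if_splits)
  next
    case False
    have h: "hd ps = hd qs'"
    proof -
      have a: "tree_adj x (hd ps)" "tree_adj x (hd qs')" "successively tree_adj ps"
        "successively tree_adj qs'" "x \<notin> set ps" "x \<notin> set qs'" "last ps = last qs'"
        using Cons.prems qs False by (auto simp: successively_Cons)
      consider c where "hd ps = c # x" | c where "hd qs' = c # x"
        | c d where "x = c # hd ps" "x = d # hd qs'"
        using a(1,2) unfolding tree_adj_def by auto
      then show ?thesis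
      proof cases
        case 1
        have "hd qs' = c # x"
          by (rule child_paths_separate[of ps x c qs']) (use 1 a False in simp_all)
        with 1 show ?thesis by simp
      next
        case 2
        have "hd ps = c # x"
          by (rule child_paths_separate[of qs' x c ps]) (use 2 a False in simp_all)
        with 2 show ?thesis by simp
      next
        case 3
        then show ?thesis by (metis list.inject)
      qed
    qed
    show ?thesis
      using Cons.IH[of qs'] Cons.prems qs False h by (auto simp: successively_Cons)
  qed
qed simp

text \<open>Loop erasure from the front: when the new first vertex already occurs in the path found
  for the tail, everything before that occurrence is cut off.\<close>

lemma walk_shorten:
  assumes "ps \<noteq> []" "set ps \<subseteq> tree_verts k" "successively tree_adj ps"
  shows "\<exists>qs. tree_path k (hd ps) (last ps) qs \<and> length qs \<le> length ps"
  using assms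
proof (induction ps)
  case (Cons x ps)
  show ?case
  proof (cases "ps = []")
    case True
    then show ?thesis using Cons.prems by (intro exI[of _ "[x]"]) (auto simp: tree_path_def)
  next
    case False
    then obtain qs where qs: "tree_path k (hd ps) (last ps) qs" "length qs \<le> length ps"
      using Cons by (auto simp: successively_Cons)
    show ?thesis
    proof (cases "x \<in> set qs")
      case True
      then obtain us vs where uv: "qs = us @ x # vs" by (meson split_list)
      show ?thesis
        by (rule exI[of _ "x # vs"])
          (use qs uv False Cons.prems in \<open>auto simp: tree_path_def successively_append_iff\<close>)
    next
      case nin: False
      show ?thesis
        by (rule exI[of _ "x # qs"])
          (use qs nin False Cons.prems in \<open>auto simp: tree_path_def successively_Cons\<close>)
    qed
  qed
qed simp

text \<open>The walk climbs from \<open>a @ u\<close> to \<open>u\<close> and then descends to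
  \<open>b @ u\<close>, using one edge per letter of \<open>a\<close> and \<open>b\<close>.\<close>

lemma walk_via_ancestor:
  assumes "a @ u \<in> tree_verts k" "b @ u \<in> tree_verts k"
  shows "\<exists>ps. ps \<noteq> [] \<and> hd ps = a @ u \<and> last ps = b @ u \<and> set ps \<subseteq> tree_verts k
      \<and> successively tree_adj ps \<and> length ps = length a + length b + 1"
  using assms
proof (induction a)
  case Nil
  then show ?case
  proof (induction b)
    case Nil
    then show ?case by (intro exI[of _ "[u]"]) auto
  next
    case (Cons c b)
    then obtain ps where ps: "ps \<noteq> []" "hd ps = u" "last ps = b @ u" "set ps \<subseteq> tree_verts k"
      "successively tree_adj ps" "length ps = length b + 1"
      by (auto simp: tree_verts_def)
    show ?case
      by (rule exI[of _ "ps @ [c # b @ u]"])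
        (use ps Cons.prems in \<open>auto simp: successively_append_iff tree_adj_def\<close>)
  qed
next
  case (Cons c a)
  then obtain ps where ps: "ps \<noteq> []" "hd ps = a @ u" "last ps = b @ u" "set ps \<subseteq> tree_verts k"
      "successively tree_adj ps" "length ps = length a + length b + 1"
    by (auto simp: tree_verts_def)
  show ?case
    by (rule exI[of _ "(c # a @ u) # ps"])
      (use ps Cons.prems in \<open>auto simp: successively_Cons tree_adj_def\<close>)
qed

text \<open>Converse of the preceding construction. Prepending an edge to a walk lengthens or
  shortens the ascent by one, or forces the ancestor one level up.\<close>

lemma walk_common_ancestor:
  assumes "ps \<noteq> []" "successively tree_adj ps"
  shows "\<exists>a b u. hd ps = a @ u \<and> last ps = b @ u \<and> length a + length b + 1 \<le> length ps"
  using assms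
proof (induction ps)
  case (Cons x ps)
  show ?case
  proof (cases "ps = []")
    case True
    then show ?thesis by (auto intro!: exI[of _ "[]"])
  next
    case False
    then obtain a b u where abu: "hd ps = a @ u" "last ps = b @ u"
      "length a + length b + 1 \<le> length ps" and adj: "tree_adj x (hd ps)"
      using Cons by (auto simp: successively_Cons)
    from adj consider c where "x = c # hd ps" | c where "hd ps = c # x"
      unfolding tree_adj_def by auto
    then show ?thesis
    proof cases
      case 1
      then show ?thesis using abu False by (intro exI[of _ "c # a"] exI[of _ b] exI[of _ u]) auto
    next
      case 2
      show ?thesis
      proof (cases a)
        \<comment> \<open>Here the old ancestor \<open>u\<close> is \<open>c # x\<close>. Its parent
          \<open>x\<close> becomes the new ancestor, and the descent gains the letter
          \<open>c\<close> at the end of its word.\<close>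
        case Nil
        then show ?thesis using abu False 2
          by (intro exI[of _ "[]"] exI[of _ "b @ [c]"] exI[of _ x]) auto
      next
        case (Cons d a')
        then show ?thesis using abu False 2
          by (intro exI[of _ a'] exI[of _ b] exI[of _ u]) auto
      qed
    qed
  qed
qed simp

text \<open>Replaces paths by decompositions with a common suffix, the only form in which the
  distance is used afterwards.\<close>

lemma tree_dist_le_iff:
  assumes x: "x \<in> tree_verts k" and y: "y \<in> tree_verts k"
  shows "tree_dist k x y \<le> r \<longleftrightarrow>
    (\<exists>a b u. x = a @ u \<and> y = b @ u \<and> length a + length b \<le> r)"
proof -
  have dist: "tree_dist k x y = length ps - 1" if "tree_path k x y ps" for ps
  proof -
    have "(THE ps. tree_path k x y ps) = ps"
      using that tree_path_unique[of _ ps]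
      by (intro the_equality) (simp_all add: tree_path_def)
    then show ?thesis by (simp add: tree_dist_def)
  qed
  have short: "\<exists>ps. tree_path k x y ps \<and> length ps \<le> length a + length b + 1"
    if "x = a @ u" "y = b @ u" for a b u
    using walk_via_ancestor[of a u k b] walk_shorten x y unfolding that by metis
  show ?thesis
  proof
    assume le: "tree_dist k x y \<le> r"
    \<comment> \<open>Taking the root as common ancestor shows that some path exists.\<close>
    from short[of x "[]" y] obtain ps where ps: "tree_path k x y ps" by auto
    with walk_common_ancestor[of ps] obtain a b u
      where "x = a @ u" "y = b @ u" "length a + length b + 1 \<le> length ps"
      unfolding tree_path_def by metis
    then show "\<exists>a b u. x = a @ u \<and> y = b @ u \<and> length a + length b \<le> r"
      using dist[OF ps] le by (intro exI[of _ a] exI[of _ b] exI[of _ u]) auto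
  next
    assume "\<exists>a b u. x = a @ u \<and> y = b @ u \<and> length a + length b \<le> r"
    then obtain a b u where abu: "x = a @ u" "y = b @ u" "length a + length b \<le> r" by auto
    from short[OF abu(1,2)] obtain ps
      where "tree_path k x y ps" "length ps \<le> length a + length b + 1" by auto
    with dist abu(3) show "tree_dist k x y \<le> r" by fastforce
  qed
qed

section \<open>Cousins and the size of balls\<close>

definition cousins :: "nat \<Rightarrow> nat \<Rightarrow> nat \<Rightarrow> nat list \<Rightarrow> nat list set" where
  "cousins k i j x =
     {y \<in> tree_verts k. i \<le> length x \<and> j \<le> length y \<and> drop i x = drop j y}"

lemma cousins_sym:
  "x \<in> tree_verts k \<Longrightarrow> y \<in> tree_verts k \<Longrightarrow> y \<in> cousins k i j x \<longleftrightarrow> x \<in> cousins k j i y"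
  by (auto simp: cousins_def)

lemma cousins_subset: "cousins k i j x \<subseteq> tree_verts k"
  by (auto simp: cousins_def)

lemma drop_tree_verts: "x \<in> tree_verts k \<Longrightarrow> drop i x \<in> tree_verts k"
  by (auto simp: tree_verts_def dest: in_set_dropD)

text \<open>Presents the cousins as an injective image of the words of length \<open>j\<close>,
  which yields finiteness and the count \<open>k ^ j\<close>.\<close>

lemma cousins_eq:
  assumes "x \<in> tree_verts k"
  shows "cousins k i j x =
    (if i \<le> length x then (\<lambda>b. b @ drop i x) ` {b. set b \<subseteq> {..<k} \<and> length b = j} else {})"
proof -
  have "y \<in> (\<lambda>b. b @ drop i x) ` {b. set b \<subseteq> {..<k} \<and> length b = j}"
    if "y \<in> cousins k i j x" for y
    using that
    by (intro image_eqI[of _ _ "take j y"])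
      (auto simp: cousins_def tree_verts_def in_lists_conv_set dest: in_set_takeD)
  moreover have "b @ drop i x \<in> cousins k i j x"
    if "i \<le> length x" "set b \<subseteq> {..<k}" "length b = j" for b
    using that drop_tree_verts[OF assms, of i] by (auto simp: cousins_def tree_verts_def)
  moreover have "cousins k i j x = {}" if "\<not> i \<le> length x"
    using that by (simp add: cousins_def)
  ultimately show ?thesis by (auto split: if_splits)
qed

lemma finite_cousins [simp]: "x \<in> tree_verts k \<Longrightarrow> finite (cousins k i j x)"
  by (simp add: cousins_eq finite_lists_length_eq)

lemma card_cousins:
  "x \<in> tree_verts k \<Longrightarrow> card (cousins k i j x) = (if i \<le> length x then k ^ j else 0)"
  by (simp add: cousins_eq card_image inj_on_def card_lists_length_eq)

text \<open>The union need not be disjoint, because every common ancestor within reach counts and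
  not only the nearest one. This is harmless for upper bounds by sums over \<open>i\<close> and
  \<open>j\<close>.\<close>

lemma tree_ball_eq:
  assumes x: "x \<in> tree_verts k"
  shows "tree_ball k x r = (\<Union>i\<le>r. \<Union>j\<le>r - i. cousins k i j x)"
proof (intro set_eqI iffI)
  fix y assume "y \<in> tree_ball k x r"
  then obtain a b u where "y \<in> tree_verts k" "x = a @ u" "y = b @ u" "length a + length b \<le> r"
    using tree_dist_le_iff[OF x] by (auto simp: tree_ball_def)
  then show "y \<in> (\<Union>i\<le>r. \<Union>j\<le>r - i. cousins k i j x)"
    by (intro UN_I[of "length a"] UN_I[of "length b"]) (auto simp: cousins_def)
next
  fix y assume "y \<in> (\<Union>i\<le>r. \<Union>j\<le>r - i. cousins k i j x)"
  then obtain i j where "i \<le> r" "j \<le> r - i" and y: "y \<in> cousins k i j x" by blast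
  then have ij: "i + j \<le> r" by simp
  from y have d: "drop i x = drop j y" "y \<in> tree_verts k" by (simp_all add: cousins_def)
  have "x = take i x @ drop j y" by (simp flip: d(1))
  moreover have "y = take j y @ drop j y" by simp
  moreover have "length (take i x) + length (take j y) \<le> r" using ij by simp
  ultimately show "y \<in> tree_ball k x r"
    using tree_dist_le_iff[OF x, of y r] d(2) unfolding tree_ball_def by blast
qed

lemma finite_tree_ball [simp]: "x \<in> tree_verts k \<Longrightarrow> finite (tree_ball k x r)"
  by (simp add: tree_ball_eq)

lemma sum_powers_le:
  fixes k :: nat
  assumes "k \<ge> 2"
  shows "(\<Sum>j\<le>n. k ^ j) \<le> 2 * k ^ n"
proof (induction n)
  case (Suc n)
  have "2 * k ^ n \<le> k * k ^ n" using assms by (rule mult_le_mono1)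
  moreover have "(\<Sum>j\<le>Suc n. k ^ j) = (\<Sum>j\<le>n. k ^ j) + k * k ^ n" "2 * k ^ Suc n = 2 * (k * k ^ n)"
    by simp_all
  ultimately show ?case using Suc by linarith
qed simp

text \<open>Two nested geometric sums are involved, over \<open>j\<close> and then over
  \<open>i\<close>, and each costs a factor 2.\<close>

lemma card_tree_ball_le:
  assumes k: "k \<ge> 2" and x: "x \<in> tree_verts k"
  shows "card (tree_ball k x r) \<le> 4 * k ^ r"
proof -
  have "card (tree_ball k x r) \<le> (\<Sum>i\<le>r. \<Sum>j\<le>r - i. card (cousins k i j x))"
    unfolding tree_ball_eq[OF x]
    by (intro order_trans[OF card_UN_le] sum_mono) auto
  also have "\<dots> \<le> (\<Sum>i\<le>r. \<Sum>j\<le>r - i. k ^ j)"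
    by (intro sum_mono) (simp add: card_cousins[OF x])
  also have "\<dots> \<le> (\<Sum>i\<le>r. 2 * k ^ (r - i))"
    by (intro sum_mono sum_powers_le[OF k])
  also have "\<dots> = 2 * (\<Sum>i\<le>r. k ^ i)"
    unfolding sum_distrib_left
    by (rule sum.reindex_bij_witness[of _ "\<lambda>i. r - i" "\<lambda>i. r - i"]) auto
  also have "\<dots> \<le> 4 * k ^ r" using sum_powers_le[OF k, of r] by simp
  finally show ?thesis .
qed

text \<open>The descendants of \<open>x\<close> exactly \<open>r\<close> generations below it
  already number \<open>k ^ r\<close>.\<close>

lemma card_tree_ball_ge:
  assumes x: "x \<in> tree_verts k"
  shows "k ^ r \<le> card (tree_ball k x r)"
proof -
  have "cousins k 0 r x \<subseteq> tree_ball k x r"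
    unfolding tree_ball_eq[OF x] by force
  from card_mono[OF finite_tree_ball[OF x] this] show ?thesis by (simp add: card_cousins[OF x])
qed

section \<open>Infinite sums, Jensen's inequality and powers\<close>

text \<open>Turns the sum in the norm into an integral, so that Tonelli and the exchange of integral
  and series become available.\<close>

lemma nn_integral_count_space_eq_infsum:
  fixes f :: "'a \<Rightarrow> ennreal"
  assumes "countable A"
  shows "(\<integral>\<^sup>+x. f x \<partial>count_space A) = (\<Sum>\<^sub>\<infinity>x\<in>A. f x)"
proof (cases "finite A")
  case True
  then show ?thesis by (simp add: nn_integral_count_space_finite)
next
  case False
  then have g: "bij_betw (from_nat_into A) UNIV A"
    using assms by (rule bij_betw_from_nat_into[rotated])
  have "(\<integral>\<^sup>+x. f x \<partial>count_space A) = (\<Sum>i. f (from_nat_into A i))"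
    by (simp add: nn_integral_bij_count_space[OF g, symmetric] nn_integral_count_space_nat)
  also have "\<dots> = (\<Sum>\<^sub>\<infinity>i. f (from_nat_into A i))"
    by (rule sums_unique[symmetric, OF has_sum_imp_sums, OF has_sum_infsum])
      (rule nonneg_summable_on_complete, simp)
  also have "\<dots> = (\<Sum>\<^sub>\<infinity>x\<in>A. f x)"
    by (rule infsum_reindex_bij_betw[OF g])
  finally show ?thesis .
qed

text \<open>Jensen's inequality for the convex function \<open>t powr p\<close> with weights
  \<open>c\<close> that need not sum to 1; normalising them produces the power of their total
  mass.\<close>

lemma powr_sum_le:
  fixes c a :: "'a \<Rightarrow> real"
  assumes I: "finite I" and p: "p \<ge> 1"
    and c: "\<And>i. i \<in> I \<Longrightarrow> c i \<ge> 0" and a: "\<And>i. i \<in> I \<Longrightarrow> a i \<ge> 0"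
  shows "(\<Sum>i\<in>I. c i * a i) powr p \<le> (\<Sum>i\<in>I. c i) powr (p - 1) * (\<Sum>i\<in>I. c i * a i powr p)"
proof -
  \<comment> \<open>Only terms with positive weight and positive value are kept. The sum on the left
    is unchanged, the total weight \<open>s\<close> is positive as soon as a term remains, and all
    points lie in the open half-line.\<close>
  define J where "J = {i \<in> I. c i > 0 \<and> a i > 0}"
  define s where "s = (\<Sum>i\<in>J. c i)"
  have J: "finite J" "J \<subseteq> I" using I by (auto simp: J_def)
  have IJ: "(\<Sum>i\<in>I. c i * a i) = (\<Sum>i\<in>J. c i * a i)"
    by (rule sum.mono_neutral_right) (use I c a in \<open>force simp: J_def order_le_less\<close>)+
  show ?thesis
  proof (cases "J = {}")
    case True
    then show ?thesis using IJ c by (simp add: sum_nonneg)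
  next
    case False
    have s: "s > 0" unfolding s_def using J False by (intro sum_pos) (auto simp: J_def)
    have "(\<Sum>i\<in>J. (c i / s) *\<^sub>R a i) powr p \<le> (\<Sum>i\<in>J. (c i / s) * a i powr p)"
      by (rule convex_on_sum[OF J(1) False powr_convex[OF p]])
        (use s in \<open>auto simp: J_def s_def simp flip: sum_divide_distrib\<close>)
    moreover have "(\<Sum>i\<in>J. (c i / s) *\<^sub>R a i) = (\<Sum>i\<in>J. c i * a i) / s"
      "(\<Sum>i\<in>J. (c i / s) * a i powr p) = (\<Sum>i\<in>J. c i * a i powr p) / s"
      by (simp_all add: sum_divide_distrib)
    moreover have "(\<Sum>i\<in>J. c i * a i) \<ge> 0" by (intro sum_nonneg) (auto simp: J_def)
    ultimately have "(\<Sum>i\<in>J. c i * a i) powr p \<le> s powr (p - 1) * (\<Sum>i\<in>J. c i * a i powr p)"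
      using s by (simp add: powr_divide powr_diff divide_le_eq mult.commute)
    also have "\<dots> \<le> (\<Sum>i\<in>I. c i) powr (p - 1) * (\<Sum>i\<in>I. c i * a i powr p)"
      unfolding s_def using I J c p
      by (intro mult_mono powr_mono2 sum_mono2 sum_nonneg) (auto simp: J_def)
    finally show ?thesis by (simp add: IJ)
  qed
qed

lemma ennpowr_ennreal [simp]: "x \<ge> 0 \<Longrightarrow> ennpowr (ennreal x) a = ennreal (x powr a)"
  by (simp add: ennpowr_def)

lemma ennpowr_mono:
  assumes "u \<le> v" "a \<ge> 0"
  shows "ennpowr u a \<le> ennpowr v a"
proof (cases "v = \<infinity>")
  case False
  then have "u < \<infinity>" "v < \<infinity>" using assms by (auto simp: less_top le_less_trans)
  then show ?thesis using assms
    by (auto simp: ennpowr_def intro!: ennreal_leI powr_mono2 enn2real_mono)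
qed (simp add: ennpowr_def)

lemma ennpowr_mult:
  assumes "c > 0"
  shows "ennpowr (ennreal c * u) a = ennreal (c powr a) * ennpowr u a"
proof (cases u)
  case (real r)
  then show ?thesis using assms by (simp add: powr_mult flip: ennreal_mult)
next
  case top
  then show ?thesis using assms by (simp add: ennpowr_def ennreal_mult_top)
qed

text \<open>Continuity of the power is avoided: a finite bound \<open>l\<close> on the powers
  becomes the bound \<open>l powr (1 / p)\<close> on every term, hence on the supremum.\<close>

lemma ennpowr_SUP_le:
  assumes "p > 0" "\<And>r. h r \<ge> 0" "\<And>r. ennreal (h r powr p) \<le> L"
  shows "ennpowr (SUP r. ennreal (h r)) p \<le> L"
proof (cases L)
  case (real l)
  have "h r \<le> l powr (1 / p)" for r
    using powr_mono2[of "1 / p" "h r powr p" l] assms real by (simp add: powr_powr)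
  then have "(SUP r. ennreal (h r)) \<le> ennreal (l powr (1 / p))"
    by (auto intro!: SUP_least ennreal_leI)
  from ennpowr_mono[OF this, of p] show ?thesis using real assms(1) by (simp add: powr_powr)
qed simp

section \<open>Domination of the maximal function by cousin averages\<close>

text \<open>This is \<open>A\<^sub>i\<^sub>j\<close> applied to the absolute value of
  \<open>f\<close>. The divisor is not the number of cousins, so the kernel has total mass at most
  \<open>(1 / k) ^ i\<close> at each vertex.\<close>

definition cousin_avg :: "nat \<Rightarrow> (nat list \<Rightarrow> real) \<Rightarrow> nat \<Rightarrow> nat \<Rightarrow> nat list \<Rightarrow> real" where
  "cousin_avg k f i j x = (\<Sum>y\<in>cousins k i j x. \<bar>f y\<bar>) / k ^ (i + j)"

lemma cousin_avg_nonneg: "cousin_avg k f i j x \<ge> 0"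
  by (simp add: cousin_avg_def sum_nonneg)

lemma sum_UN_le:
  fixes f :: "'b \<Rightarrow> real"
  assumes "finite I" "\<And>i. i \<in> I \<Longrightarrow> finite (A i)" "\<And>x. f x \<ge> 0"
  shows "(\<Sum>x\<in>(\<Union>i\<in>I. A i). f x) \<le> (\<Sum>i\<in>I. \<Sum>x\<in>A i. f x)"
  using assms(1,2)
proof (induction I)
  case (insert i I)
  have "(\<Sum>x\<in>A i \<union> (\<Union>i\<in>I. A i). f x) \<le> (\<Sum>x\<in>A i. f x) + (\<Sum>x\<in>(\<Union>i\<in>I. A i). f x)"
    using insert assms(3) by (simp add: sum_Un sum_nonneg)
  with insert show ?case by simp
qed simp

text \<open>The ball has at least \<open>k ^ r\<close> points and only pairs with
  \<open>i + j\<close> at most \<open>r\<close> contribute, so dividing by its cardinality loses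
  nothing against dividing each cousin sum by \<open>k ^ (i + j)\<close>.\<close>

lemma ball_avg_le:
  assumes k: "k \<ge> 2" and x: "x \<in> tree_verts k"
  shows "1 / real (card (tree_ball k x r)) * (\<Sum>y\<in>tree_ball k x r. \<bar>f y\<bar>)
    \<le> (\<Sum>(i, j)\<in>{..r} \<times> {..r}. cousin_avg k f i j x)"
proof -
  have fin: "finite (\<Union>j\<le>r - i. cousins k i j x)" for i using x by simp
  have "(\<Sum>y\<in>tree_ball k x r. \<bar>f y\<bar>) \<le> (\<Sum>i\<le>r. \<Sum>j\<le>r - i. \<Sum>y\<in>cousins k i j x. \<bar>f y\<bar>)"
    unfolding tree_ball_eq[OF x] using x fin
    by (intro order_trans[OF sum_UN_le] sum_mono sum_UN_le) auto
  also have "\<dots> \<le> (\<Sum>i\<le>r. \<Sum>j\<le>r - i. k ^ r * cousin_avg k f i j x)"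
  proof (intro sum_mono)
    fix i j assume "i \<in> {..r}" "j \<in> {..r - i}"
    then have "real k ^ (i + j) \<le> real k ^ r" using k by (intro power_increasing) auto
    then have "real k ^ (i + j) * cousin_avg k f i j x \<le> real k ^ r * cousin_avg k f i j x"
      by (intro mult_right_mono cousin_avg_nonneg)
    then show "(\<Sum>y\<in>cousins k i j x. \<bar>f y\<bar>) \<le> k ^ r * cousin_avg k f i j x"
      using k by (simp add: cousin_avg_def)
  qed
  \<comment> \<open>Enlarging the triangle of pairs to a square lets geometric weights on it factor
    into a product of two sums.\<close>
  also have "\<dots> \<le> (\<Sum>i\<le>r. \<Sum>j\<le>r. k ^ r * cousin_avg k f i j x)"
    by (intro sum_mono sum_mono2) (auto simp: cousin_avg_nonneg)
  also have "\<dots> = k ^ r * (\<Sum>(i, j)\<in>{..r} \<times> {..r}. cousin_avg k f i j x)"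
    by (simp add: sum.cartesian_product sum_distrib_left case_prod_unfold)
  also have "\<dots> \<le> card (tree_ball k x r) * (\<Sum>(i, j)\<in>{..r} \<times> {..r}. cousin_avg k f i j x)"
    using card_tree_ball_ge[OF x, of r]
    by (intro mult_right_mono sum_nonneg) (auto simp: cousin_avg_nonneg simp flip: of_nat_power)
  finally have *: "(\<Sum>y\<in>tree_ball k x r. \<bar>f y\<bar>) \<le>
    card (tree_ball k x r) * (\<Sum>(i, j)\<in>{..r} \<times> {..r}. cousin_avg k f i j x)" .
  have "0 < k ^ r" using k by simp
  then have "card (tree_ball k x r) > 0" using card_tree_ball_ge[OF x, of r] by linarith
  with * show ?thesis by (simp add: field_simps)
qed

lemma sum_geometric_le:
  fixes \<tau> :: real
  assumes "0 < \<tau>" "\<tau> < 1"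
  shows "(\<Sum>i\<le>r. \<tau> ^ i) \<le> 1 / (1 - \<tau>)"
  using assms by (simp add: sum_gp0 divide_right_mono)

lemma sum_le_suminf_suminf:
  fixes h :: "nat \<Rightarrow> nat \<Rightarrow> ennreal"
  shows "(\<Sum>(i, j)\<in>{..r} \<times> {..r}. h i j) \<le> (\<Sum>i. \<Sum>j. h i j)"
proof -
  have "(\<Sum>(i, j)\<in>{..r} \<times> {..r}. h i j) = (\<Sum>i\<le>r. \<Sum>j\<le>r. h i j)"
    by (simp add: sum.cartesian_product)
  also have "\<dots> \<le> (\<Sum>i\<le>r. \<Sum>j. h i j)"
    by (intro sum_mono sum_le_suminf) auto
  also have "\<dots> \<le> (\<Sum>i. \<Sum>j. h i j)"
    by (intro sum_le_suminf) auto
  finally show ?thesis .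
qed

text \<open>Jensen's inequality with the summable weights \<open>\<tau> ^ (i + j)\<close> moves the
  power inside the sum over pairs. The price is the divisor \<open>\<theta> ^ (i + j)\<close>, to be
  beaten by geometric decay; the constant does not depend on the radius, so the supremum can be
  taken.\<close>

lemma maximal_powr_le:
  assumes k: "k \<ge> 2" and x: "x \<in> tree_verts k" and p: "p > 1" and \<theta>: "0 < \<theta>" "\<theta> < 1"
  defines "\<tau> \<equiv> \<theta> powr (1 / (p - 1))"
  shows "ennpowr (maximal k f x) p \<le>
    ennreal ((1 / (1 - \<tau>) ^ 2) powr (p - 1)) *
    (\<Sum>i. \<Sum>j. ennreal (cousin_avg k f i j x powr p / \<theta> ^ (i + j)))"
  unfolding maximal_def
proof (rule ennpowr_SUP_le)
  fix r :: nat
  let ?I = "{..r} \<times> {..r}" and ?a = "\<lambda>i j. cousin_avg k f i j x"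
  have \<tau>: "0 < \<tau>" "\<tau> < 1" using \<theta> p powr_less_mono2[of "1 / (p - 1)" \<theta> 1] by (auto simp: \<tau>_def)
  \<comment> \<open>The exponent \<open>1 / (p - 1)\<close> in \<open>\<tau>\<close> is chosen so
    that \<open>\<tau> powr (1 - p)\<close> equals \<open>1 / \<theta>\<close>.\<close>
  have \<tau>\<theta>: "\<tau> ^ n * (a / \<tau> ^ n) powr p = a powr p / \<theta> ^ n" if "a \<ge> 0" for a n
  proof -
    have "\<tau> ^ n = \<theta> powr (n / (p - 1))" using \<theta> \<tau> by (simp add: \<tau>_def powr_powr flip: powr_realpow)
    moreover have "\<theta> ^ n = \<theta> powr n" using \<theta> by (simp add: powr_realpow)
    moreover have "n / (p - 1) * p = n / (p - 1) + n" using p by (simp add: field_simps)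
    ultimately show ?thesis using \<theta> that by (simp add: powr_divide powr_powr powr_add)
  qed
  have "(1 / real (card (tree_ball k x r)) * (\<Sum>y\<in>tree_ball k x r. \<bar>f y\<bar>)) powr p
      \<le> (\<Sum>(i, j)\<in>?I. ?a i j) powr p"
    using p ball_avg_le[OF k x] by (intro powr_mono2) (auto intro!: sum_nonneg divide_nonneg_nonneg)
  also have "(\<Sum>(i, j)\<in>?I. ?a i j) =
      (\<Sum>z\<in>?I. \<tau> ^ (fst z + snd z) * (?a (fst z) (snd z) / \<tau> ^ (fst z + snd z)))"
    using \<tau> by (simp add: case_prod_unfold)
  also have "\<dots> powr p \<le> (\<Sum>z\<in>?I. \<tau> ^ (fst z + snd z)) powr (p - 1) *
      (\<Sum>z\<in>?I. \<tau> ^ (fst z + snd z) * (?a (fst z) (snd z) / \<tau> ^ (fst z + snd z)) powr p)"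
    using p \<tau> by (intro powr_sum_le) (auto simp: cousin_avg_nonneg)
  also have "(\<Sum>z\<in>?I. \<tau> ^ (fst z + snd z) * (?a (fst z) (snd z) / \<tau> ^ (fst z + snd z)) powr p)
      = (\<Sum>(i, j)\<in>?I. ?a i j powr p / \<theta> ^ (i + j))"
    by (simp add: \<tau>\<theta> cousin_avg_nonneg case_prod_unfold)
  also have "(\<Sum>z\<in>?I. \<tau> ^ (fst z + snd z)) = (\<Sum>i\<le>r. \<tau> ^ i) ^ 2"
    by (simp add: power2_eq_square sum_product sum.cartesian_product case_prod_unfold power_add)
  also have "\<dots> powr (p - 1) \<le> (1 / (1 - \<tau>) ^ 2) powr (p - 1)"
    using p \<tau> power_mono[OF sum_geometric_le[OF \<tau>], of r 2]
    by (intro powr_mono2) (auto simp: power_divide sum_nonneg)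
  finally have "(1 / real (card (tree_ball k x r)) * (\<Sum>y\<in>tree_ball k x r. \<bar>f y\<bar>)) powr p
    \<le> (1 / (1 - \<tau>) ^ 2) powr (p - 1) * (\<Sum>(i, j)\<in>?I. ?a i j powr p / \<theta> ^ (i + j))"
    using \<theta> by (simp add: mult_right_mono sum_nonneg case_prod_unfold)
  then have "ennreal ((1 / real (card (tree_ball k x r)) * (\<Sum>y\<in>tree_ball k x r. \<bar>f y\<bar>)) powr p)
    \<le> ennreal ((1 / (1 - \<tau>) ^ 2) powr (p - 1)) * (\<Sum>(i, j)\<in>?I. ennreal (?a i j powr p / \<theta> ^ (i + j)))"
    using \<theta> by (simp add: case_prod_unfold sum_nonneg flip: ennreal_mult)
  also have "\<dots> \<le> ennreal ((1 / (1 - \<tau>) ^ 2) powr (p - 1)) *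
    (\<Sum>i. \<Sum>j. ennreal (?a i j powr p / \<theta> ^ (i + j)))"
    by (intro mult_left_mono sum_le_suminf_suminf) auto
  finally show "ennreal ((1 / real (card (tree_ball k x r)) * (\<Sum>y\<in>tree_ball k x r. \<bar>f y\<bar>)) powr p)
    \<le> \<dots>" .
qed (use p in \<open>auto intro!: sum_nonneg divide_nonneg_nonneg\<close>)

section \<open>From kernel estimates to weighted bounds\<close>

text \<open>Tonelli's theorem for the indicator of the cousin relation, whose transpose is the
  cousin relation with \<open>i\<close> and \<open>j\<close> exchanged.\<close>

lemma nn_integral_cousins_swap:
  fixes g :: "nat list \<Rightarrow> nat list \<Rightarrow> ennreal"
  shows "(\<integral>\<^sup>+x. (\<Sum>y\<in>cousins k i j x. g x y) \<partial>count_space (tree_verts k)) =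
    (\<integral>\<^sup>+y. (\<Sum>x\<in>cousins k j i y. g x y) \<partial>count_space (tree_verts k))"
proof -
  let ?V = "count_space (tree_verts k)"
  have "(\<integral>\<^sup>+x. (\<Sum>y\<in>cousins k i j x. g x y) \<partial>?V) =
    (\<integral>\<^sup>+x. \<integral>\<^sup>+y. (if y \<in> cousins k i j x then g x y else 0) \<partial>?V \<partial>?V)"
    by (intro nn_integral_cong, subst nn_integral_count_space'[of "cousins k i j _"])
      (auto simp: cousins_subset)
  also have "\<dots> = (\<integral>\<^sup>+y. \<integral>\<^sup>+x. (if y \<in> cousins k i j x then g x y else 0) \<partial>?V \<partial>?V)"
    by (rule nn_integral_count_space_nn_integral) auto
  also have "\<dots> = (\<integral>\<^sup>+y. \<integral>\<^sup>+x. (if x \<in> cousins k j i y then g x y else 0) \<partial>?V \<partial>?V)"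
    by (intro nn_integral_cong) (auto simp: cousins_sym)
  also have "\<dots> = (\<integral>\<^sup>+y. (\<Sum>x\<in>cousins k j i y. g x y) \<partial>?V)"
    by (intro nn_integral_cong, subst nn_integral_count_space'[of "cousins k j i _"])
      (auto simp: cousins_subset)
  finally show ?thesis .
qed

lemma suminf_suminf_geometric:
  assumes "0 < \<theta>" "\<theta> < 1"
  shows "(\<Sum>i. \<Sum>j. ennreal (\<theta> ^ (i + j))) = ennreal ((1 / (1 - \<theta>)) ^ 2)"
proof -
  have s: "(\<Sum>i. ennreal (\<theta> ^ i)) = ennreal (1 / (1 - \<theta>))"
    using assms by (subst suminf_ennreal2) (auto simp: summable_geometric suminf_geometric)
  have "(\<Sum>i. \<Sum>j. ennreal (\<theta> ^ (i + j))) = (\<Sum>i. ennreal (\<theta> ^ i) * (\<Sum>j. ennreal (\<theta> ^ j)))"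
    using assms by (simp add: power_add ennreal_mult flip: ennreal_suminf_cmult)
  also have "\<dots> = ennreal (1 / (1 - \<theta>)) * ennreal (1 / (1 - \<theta>))"
    by (simp add: s)
  finally show ?thesis using assms by (simp add: power2_eq_square flip: ennreal_mult)
qed

text \<open>A test of Schur type. By \<open>avg\<close>, the power of each average is bounded
  linearly in \<open>\<bar>f y\<bar> powr p * v y\<close>, so after Tonelli only the column sums of
  \<open>G\<close> matter, and \<open>col\<close> makes them summable over \<open>i\<close> and
  \<open>j\<close> with room to spare.\<close>

lemma maximal_bounded_if_kernel:
  fixes v :: "nat list \<Rightarrow> real" and G :: "nat \<Rightarrow> nat \<Rightarrow> nat list \<Rightarrow> nat list \<Rightarrow> real"
  assumes k: "k \<ge> 2" and p: "p > 1" and v: "\<And>x. x \<in> tree_verts k \<Longrightarrow> v x > 0"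
    and \<alpha>: "0 < \<alpha>" "\<alpha> < 1" and \<beta>: "0 < \<beta>" "\<beta> < 1" and D: "D > 0"
    and G: "\<And>i j x y. x \<in> tree_verts k \<Longrightarrow> y \<in> tree_verts k \<Longrightarrow> G i j x y \<ge> 0"
    and avg: "\<And>f i j x. x \<in> tree_verts k \<Longrightarrow>
      cousin_avg k f i j x powr p * v x \<le> (\<Sum>y\<in>cousins k i j x. G i j x y * (\<bar>f y\<bar> powr p * v y))"
    and col: "\<And>i j y. y \<in> tree_verts k \<Longrightarrow> (\<Sum>x\<in>cousins k j i y. G i j x y) \<le> D * \<alpha> ^ i * \<beta> ^ j"
  shows "\<exists>C::real. C > 0 \<and> (\<forall>f. Lq_norm k p v (maximal k f) \<le> ennreal C * Lq_norm k p v (\<lambda>x. ennreal \<bar>f x\<bar>))"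
proof -
  \<comment> \<open>The square root splits the decay in two halves: one pays for the divisor
    \<open>\<theta> ^ (i + j)\<close>, the other makes the double series converge.\<close>
  define \<theta> where "\<theta> = sqrt (max \<alpha> \<beta>)"
  define \<tau> where "\<tau> = \<theta> powr (1 / (p - 1))"
  define H where "H = (1 / (1 - \<tau>) ^ 2) powr (p - 1)"
  define B where "B = H * (D * (1 / (1 - \<theta>)) ^ 2)"
  let ?V = "count_space (tree_verts k)"
  have \<theta>: "0 < \<theta>" "\<theta> < 1" using \<alpha> \<beta> by (auto simp: \<theta>_def)
  have \<tau>: "\<tau> < 1" using \<theta> p powr_less_mono2[of "1 / (p - 1)" \<theta> 1] by (auto simp: \<tau>_def)
  then have H: "H > 0" by (simp add: H_def)
  then have B: "B > 0" using D \<theta> by (simp add: B_def)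
  have col': "(\<Sum>x\<in>cousins k j i y. G i j x y) / \<theta> ^ (i + j) \<le> D * \<theta> ^ (i + j)"
    if "y \<in> tree_verts k" for i j y
  proof -
    have "\<alpha> ^ i * \<beta> ^ j \<le> (\<theta> ^ 2) ^ i * (\<theta> ^ 2) ^ j"
      using \<alpha> \<beta> by (intro mult_mono power_mono) (auto simp: \<theta>_def)
    also have "\<dots> = \<theta> ^ (i + j) * \<theta> ^ (i + j)"
      by (simp add: power_add power2_eq_square power_mult_distrib)
    finally have "D * \<alpha> ^ i * \<beta> ^ j \<le> D * \<theta> ^ (i + j) * \<theta> ^ (i + j)"
      using D by (simp add: mult.assoc)
    with col[OF that, of i j] \<theta> show ?thesis by (simp add: divide_le_eq)
  qed
  have main: "(\<Sum>\<^sub>\<infinity>x\<in>tree_verts k. ennpowr (maximal k f x) p * ennreal (v x)) \<le>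
      ennreal B * (\<Sum>\<^sub>\<infinity>x\<in>tree_verts k. ennpowr (ennreal \<bar>f x\<bar>) p * ennreal (v x))" for f
  proof -
    define F where "F y = \<bar>f y\<bar> powr p * v y" for y
    have F: "F y \<ge> 0" if "y \<in> tree_verts k" for y
      using v[OF that] by (simp add: F_def)
    have avg': "ennreal (cousin_avg k f i j x powr p / \<theta> ^ (i + j)) * ennreal (v x)
        \<le> (\<Sum>y\<in>cousins k i j x. ennreal (G i j x y / \<theta> ^ (i + j) * F y))"
      if x: "x \<in> tree_verts k" for x i j
    proof -
      have y: "y \<in> cousins k i j x \<Longrightarrow> y \<in> tree_verts k" for y by (simp add: cousins_def)
      have "cousin_avg k f i j x powr p / \<theta> ^ (i + j) * v x
          \<le> (\<Sum>y\<in>cousins k i j x. G i j x y * F y) / \<theta> ^ (i + j)"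
        using avg[OF x, of f i j] \<theta> by (simp add: F_def divide_right_mono)
      also have "\<dots> = (\<Sum>y\<in>cousins k i j x. G i j x y / \<theta> ^ (i + j) * F y)"
        by (simp add: sum_divide_distrib)
      finally show ?thesis
        using \<theta> v[OF x] G[OF x] F y by (simp add: ennreal_leI flip: ennreal_mult)
    qed
    have col'': "(\<Sum>x\<in>cousins k j i y. ennreal (G i j x y / \<theta> ^ (i + j) * F y))
        \<le> ennreal D * ennreal (\<theta> ^ (i + j)) * ennreal (F y)"
      if y: "y \<in> tree_verts k" for y i j
    proof -
      have x: "x \<in> cousins k j i y \<Longrightarrow> x \<in> tree_verts k" for x by (simp add: cousins_def)
      have "(\<Sum>x\<in>cousins k j i y. G i j x y / \<theta> ^ (i + j) * F y)
          = (\<Sum>x\<in>cousins k j i y. G i j x y) / \<theta> ^ (i + j) * F y"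
        by (simp add: sum_divide_distrib sum_distrib_right)
      also have "\<dots> \<le> D * \<theta> ^ (i + j) * F y"
        by (intro mult_right_mono col' F y)
      finally show ?thesis
        using \<theta> D F[OF y] G[OF x y] by (simp add: ennreal_leI flip: ennreal_mult)
    qed
    have "(\<Sum>\<^sub>\<infinity>x\<in>tree_verts k. ennpowr (maximal k f x) p * ennreal (v x))
        = (\<integral>\<^sup>+x. ennpowr (maximal k f x) p * ennreal (v x) \<partial>?V)"
      by (simp add: nn_integral_count_space_eq_infsum)
    also have "\<dots> \<le> (\<integral>\<^sup>+x. ennreal H *
        (\<Sum>i. \<Sum>j. ennreal (cousin_avg k f i j x powr p / \<theta> ^ (i + j)) * ennreal (v x)) \<partial>?V)"
    proof (intro nn_integral_mono)
      fix x assume "x \<in> space ?V"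
      then have "x \<in> tree_verts k" by simp
      from maximal_powr_le[OF k this p \<theta>, of f]
      have "ennpowr (maximal k f x) p * ennreal (v x) \<le>
        ennreal H * (\<Sum>i. \<Sum>j. ennreal (cousin_avg k f i j x powr p / \<theta> ^ (i + j))) * ennreal (v x)"
        unfolding H_def \<tau>_def by (rule mult_right_mono) simp
      then show "ennpowr (maximal k f x) p * ennreal (v x) \<le> ennreal H *
          (\<Sum>i. \<Sum>j. ennreal (cousin_avg k f i j x powr p / \<theta> ^ (i + j)) * ennreal (v x))"
        by (simp add: mult.assoc)
    qed
    also have "\<dots> \<le> (\<integral>\<^sup>+x. ennreal H *
        (\<Sum>i. \<Sum>j. \<Sum>y\<in>cousins k i j x. ennreal (G i j x y / \<theta> ^ (i + j) * F y)) \<partial>?V)"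
      by (intro nn_integral_mono mult_left_mono suminf_le avg') auto
    also have "\<dots> = ennreal H *
        (\<Sum>i. \<Sum>j. \<integral>\<^sup>+x. (\<Sum>y\<in>cousins k i j x. ennreal (G i j x y / \<theta> ^ (i + j) * F y)) \<partial>?V)"
      by (simp add: nn_integral_cmult nn_integral_suminf)
    also have "\<dots> = ennreal H *
        (\<Sum>i. \<Sum>j. \<integral>\<^sup>+y. (\<Sum>x\<in>cousins k j i y. ennreal (G i j x y / \<theta> ^ (i + j) * F y)) \<partial>?V)"
      by (subst nn_integral_cousins_swap) (rule refl)
    also have "\<dots> \<le> ennreal H *
        (\<Sum>i. \<Sum>j. \<integral>\<^sup>+y. ennreal D * ennreal (\<theta> ^ (i + j)) * ennreal (F y) \<partial>?V)"
      by (intro mult_left_mono suminf_le nn_integral_mono col'') auto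
    also have "\<dots> = ennreal H * (ennreal D * (\<Sum>i. \<Sum>j. ennreal (\<theta> ^ (i + j))) * (\<integral>\<^sup>+y. ennreal (F y) \<partial>?V))"
      by (simp add: nn_integral_cmult)
    also have "\<dots> = ennreal B * (\<integral>\<^sup>+y. ennreal (F y) \<partial>?V)"
      using \<theta> D H by (simp add: suminf_suminf_geometric[OF \<theta>] B_def ennreal_mult mult.assoc)
    also have "(\<integral>\<^sup>+y. ennreal (F y) \<partial>?V) = (\<Sum>\<^sub>\<infinity>y\<in>tree_verts k. ennreal (F y))"
      by (simp add: nn_integral_count_space_eq_infsum)
    also have "\<dots> = (\<Sum>\<^sub>\<infinity>y\<in>tree_verts k. ennpowr (ennreal \<bar>f y\<bar>) p * ennreal (v y))"
      by (intro infsum_cong) (use v in \<open>auto simp: F_def less_imp_le simp flip: ennreal_mult\<close>)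
    finally show ?thesis .
  qed
  have "Lq_norm k p v (maximal k f) \<le> ennreal (B powr (1 / p)) * Lq_norm k p v (\<lambda>x. ennreal \<bar>f x\<bar>)" for f
    unfolding Lq_norm_def ennpowr_mult[OF B, symmetric]
    using p by (intro ennpowr_mono main) auto
  then show ?thesis using B by (intro exI[of _ "B powr (1 / p)"]) auto
qed

section \<open>Decay of the cousin averages of the weight\<close>

text \<open>The ball of radius \<open>i + j\<close> contains the cousins, so the hypothesis controls
  the sum of \<open>w powr s\<close> over them. Jensen's inequality with exponent \<open>s\<close>
  then gains a power of the kernel mass.\<close>

lemma cousin_weight_le:
  assumes k: "k \<ge> 2" and w: "\<And>x. x \<in> tree_verts k \<Longrightarrow> w x > 0" and s: "s > 1" and C: "C > 0"
    and M: "\<And>x. x \<in> tree_verts k \<Longrightarrow> maximal_s k s w x \<le> ennreal C * ennreal (w x)"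
    and x: "x \<in> tree_verts k"
  shows "(\<Sum>y\<in>cousins k i j x. w y) / k ^ (i + j) \<le>
    4 powr (1 / s) * C * ((1 / k) powr ((s - 1) / s)) ^ i * w x"
proof -
  let ?B = "tree_ball k x (i + j)" and ?N = "cousins k i j x"
  let ?avg = "\<lambda>r. 1 / real (card (tree_ball k x r)) * (\<Sum>y\<in>tree_ball k x r. \<bar>w y powr s\<bar>)"
  have avg0: "?avg r \<ge> 0" for r by (simp add: sum_nonneg)
  have wx: "w x > 0" using w x by blast
  have "ennreal (?avg (i + j)) \<le> maximal k (\<lambda>y. w y powr s) x"
    unfolding maximal_def by (rule SUP_upper) simp
  from ennpowr_mono[OF this, of "1 / s"] M[OF x] s
  have "ennpowr (ennreal (?avg (i + j))) (1 / s) \<le> ennreal C * ennreal (w x)"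
    unfolding maximal_s_def by (auto intro: order_trans)
  then have "?avg (i + j) powr (1 / s) \<le> C * w x"
    using avg0 C wx by (simp only: ennpowr_ennreal) (simp flip: ennreal_mult)
  from powr_mono2[OF _ _ this, of s] have "?avg (i + j) \<le> (C * w x) powr s"
    using s avg0[of "i + j"] by (simp add: powr_powr abs_of_nonneg sum_nonneg)
  moreover have "0 < card ?B"
    using card_tree_ball_ge[OF x, of "i + j"] k by (metis gr0I le_zero_eq power_not_zero zero_neq_numeral)
  ultimately have "(\<Sum>y\<in>?B. w y powr s) \<le> card ?B * (C * w x) powr s"
    by (simp add: field_simps)
  also have "\<dots> \<le> (4 * real k ^ (i + j)) * (C * w x) powr s"
    using card_tree_ball_le[OF k x, of "i + j"]
    by (intro mult_right_mono) (simp_all flip: of_nat_le_iff[where ?'a = real])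
  finally have ball: "(\<Sum>y\<in>?B. w y powr s) \<le> (4 * real k ^ (i + j)) * (C * w x) powr s" .
  have "?N \<subseteq> ?B" unfolding tree_ball_eq[OF x] by force
  then have "(\<Sum>y\<in>?N. w y powr s) \<le> (\<Sum>y\<in>?B. w y powr s)"
    using x by (intro sum_mono2) auto
  from order_trans[OF this ball] have Ns: "(\<Sum>y\<in>?N. 1 / real k ^ (i + j) * w y powr s) \<le> 4 * (C * w x) powr s"
    using k by (simp add: divide_le_eq mult_ac flip: sum_divide_distrib)
  \<comment> \<open>This mass, raised to the power \<open>s - 1\<close> and then to
    \<open>1 / s\<close>, is the source of the decay in \<open>i\<close>.\<close>
  have N1: "(\<Sum>y\<in>?N. 1 / real k ^ (i + j)) \<le> (1 / k) ^ i"
    using k by (simp add: card_cousins[OF x] power_add power_divide)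
  have "(\<Sum>y\<in>?N. 1 / real k ^ (i + j) * w y) powr s \<le>
      (\<Sum>y\<in>?N. 1 / real k ^ (i + j)) powr (s - 1) * (\<Sum>y\<in>?N. 1 / real k ^ (i + j) * w y powr s)"
    using s w x cousins_subset[of k i j x] by (intro powr_sum_le) (auto intro: less_imp_le)
  also have "\<dots> \<le> ((1 / k) ^ i) powr (s - 1) * (4 * (C * w x) powr s)"
    using s by (intro mult_mono powr_mono2 Ns N1 sum_nonneg) auto
  finally have "((\<Sum>y\<in>?N. 1 / real k ^ (i + j) * w y) powr s) powr (1 / s) \<le>
      (((1 / k) ^ i) powr (s - 1) * (4 * (C * w x) powr s)) powr (1 / s)"
    using s by (intro powr_mono2) auto
  moreover have "(\<Sum>y\<in>?N. 1 / real k ^ (i + j) * w y) \<ge> 0"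
    using w cousins_subset[of k i j x] by (intro sum_nonneg) (auto simp: less_imp_le)
  moreover have "(((1 / k) ^ i) powr (s - 1)) powr (1 / s) = ((1 / k) powr ((s - 1) / s)) ^ i"
    using k by (simp add: powr_powr mult.commute flip: powr_realpow)
  ultimately show ?thesis
    using s C wx k by (simp add: powr_powr powr_mult sum_divide_distrib mult_ac)
qed

section \<open>The bounds on the weighted space and on its dual\<close>

text \<open>Decay in \<open>i\<close> comes from Jensen's inequality, since the kernel has mass at
  most \<open>(1 / k) ^ i\<close>; decay in \<open>j\<close> comes from \<open>W\<close> in the
  column sums. The factor \<open>w x / w y\<close> in \<open>G\<close> moves the weight from
  \<open>x\<close> to \<open>y\<close>.\<close>

lemma maximal_bounded_primal:
  assumes k: "k \<ge> 2" and w: "\<And>x. x \<in> tree_verts k \<Longrightarrow> w x > 0" and p: "p > 1"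
    and E: "E > 0" and \<alpha>: "0 < \<alpha>" "\<alpha> < 1"
    and W: "\<And>i j x. x \<in> tree_verts k \<Longrightarrow>
      (\<Sum>y\<in>cousins k i j x. w y) / k ^ (i + j) \<le> E * \<alpha> ^ i * w x"
  shows "\<exists>C::real. C > 0 \<and>
    (\<forall>f. Lq_norm k p w (maximal k f) \<le> ennreal C * Lq_norm k p w (\<lambda>x. ennreal \<bar>f x\<bar>))"
proof -
  define \<beta> where "\<beta> = (1 / real k) powr (p - 1)"
  have \<beta>: "0 < \<beta>" "\<beta> < 1"
    using k p powr_less_mono2[of "p - 1" "1 / real k" 1] by (auto simp: \<beta>_def)
  show ?thesis
  proof (rule maximal_bounded_if_kernel[where G = "\<lambda>i j x y. \<beta> ^ i / k ^ (i + j) * w x / w y",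
        OF k p w \<beta> \<alpha> E])
    fix i j x y assume "x \<in> tree_verts k" "y \<in> tree_verts k"
    then show "\<beta> ^ i / k ^ (i + j) * w x / w y \<ge> 0" using w[of x] w[of y] \<beta> by simp
  next
    fix f i j x assume x: "x \<in> tree_verts k"
    let ?N = "cousins k i j x"
    have N1: "(\<Sum>y\<in>?N. 1 / real k ^ (i + j)) \<le> (1 / k) ^ i"
      using k by (simp add: card_cousins[OF x] power_add power_divide)
    have \<beta>i: "((1 / k) ^ i) powr (p - 1) = \<beta> ^ i"
      using k by (simp add: \<beta>_def powr_powr mult.commute flip: powr_realpow)
    have "cousin_avg k f i j x powr p = (\<Sum>y\<in>?N. 1 / real k ^ (i + j) * \<bar>f y\<bar>) powr p"
      by (simp add: cousin_avg_def sum_divide_distrib)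
    also have "\<dots> \<le> (\<Sum>y\<in>?N. 1 / real k ^ (i + j)) powr (p - 1) *
        (\<Sum>y\<in>?N. 1 / real k ^ (i + j) * \<bar>f y\<bar> powr p)"
      using p x by (intro powr_sum_le) auto
    also have "\<dots> \<le> ((1 / k) ^ i) powr (p - 1) * (\<Sum>y\<in>?N. 1 / real k ^ (i + j) * \<bar>f y\<bar> powr p)"
      using p by (intro mult_right_mono powr_mono2 N1 sum_nonneg) auto
    finally have "cousin_avg k f i j x powr p * w x \<le>
        \<beta> ^ i * (\<Sum>y\<in>?N. 1 / real k ^ (i + j) * \<bar>f y\<bar> powr p) * w x"
      unfolding \<beta>i using w[OF x] by (intro mult_right_mono) auto
    also have "\<dots> = (\<Sum>y\<in>?N. \<beta> ^ i / k ^ (i + j) * w x / w y * (\<bar>f y\<bar> powr p * w y))"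
      unfolding sum_distrib_left sum_distrib_right
    proof (intro sum.cong refl)
      fix y assume "y \<in> ?N"
      then have "w y \<noteq> 0" using w[of y] by (simp add: cousins_def)
      then show "\<beta> ^ i * (1 / real k ^ (i + j) * \<bar>f y\<bar> powr p) * w x =
          \<beta> ^ i / k ^ (i + j) * w x / w y * (\<bar>f y\<bar> powr p * w y)"
        by simp
    qed
    finally show "cousin_avg k f i j x powr p * w x \<le>
        (\<Sum>y\<in>?N. \<beta> ^ i / k ^ (i + j) * w x / w y * (\<bar>f y\<bar> powr p * w y))" .
  next
    fix i j y assume y: "y \<in> tree_verts k"
    have "(\<Sum>x\<in>cousins k j i y. \<beta> ^ i / k ^ (i + j) * w x / w y) =
        \<beta> ^ i / w y * ((\<Sum>x\<in>cousins k j i y. w x) / k ^ (j + i))"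
      by (simp add: sum_distrib_left sum_divide_distrib add.commute mult_ac)
    \<comment> \<open>Seen from \<open>y\<close> the cousins have type \<open>(j, i)\<close>, so
      \<open>W\<close> decays in \<open>j\<close> here.\<close>
    also have "\<dots> \<le> \<beta> ^ i / w y * (E * \<alpha> ^ j * w y)"
      using \<beta> w[OF y] by (intro mult_left_mono W y) auto
    also have "\<dots> = E * \<beta> ^ i * \<alpha> ^ j" using w[OF y] by simp
    finally show "(\<Sum>x\<in>cousins k j i y. \<beta> ^ i / k ^ (i + j) * w x / w y) \<le> E * \<beta> ^ i * \<alpha> ^ j" .
  qed
qed

text \<open>The two sources of decay change places: Jensen's inequality with the kernel times
  \<open>w\<close> as weights has its mass controlled by \<open>W\<close>, giving decay in
  \<open>i\<close>, and the column sums decay in \<open>j\<close> by counting alone.\<close>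

lemma maximal_bounded_dual:
  assumes k: "k \<ge> 2" and w: "\<And>x. x \<in> tree_verts k \<Longrightarrow> w x > 0" and q: "q > 1"
    and E: "E > 0" and \<alpha>: "0 < \<alpha>" "\<alpha> < 1"
    and W: "\<And>i j x. x \<in> tree_verts k \<Longrightarrow>
      (\<Sum>y\<in>cousins k i j x. w y) / k ^ (i + j) \<le> E * \<alpha> ^ i * w x"
  defines "\<sigma> \<equiv> \<lambda>x. w x powr (1 - q)"
  shows "\<exists>C::real. C > 0 \<and>
    (\<forall>f. Lq_norm k q \<sigma> (maximal k f) \<le> ennreal C * Lq_norm k q \<sigma> (\<lambda>x. ennreal \<bar>f x\<bar>))"
proof -
  define \<gamma> where "\<gamma> = \<alpha> powr (q - 1)"
  define D where "D = E powr (q - 1)"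
  have \<gamma>: "0 < \<gamma>" "\<gamma> < 1"
    using \<alpha> q powr_less_mono2[of "q - 1" \<alpha> 1] by (auto simp: \<gamma>_def)
  have D: "D > 0" using E by (simp add: D_def)
  have \<sigma>: "\<sigma> x > 0" if "x \<in> tree_verts k" for x using w[OF that] by (simp add: \<sigma>_def)
  have k1: "0 < 1 / real k" "1 / real k < 1" using k by auto
  show ?thesis
  proof (rule maximal_bounded_if_kernel[where G = "\<lambda>i j x y. D * \<gamma> ^ i / k ^ (i + j)",
        OF k q \<sigma> \<gamma> k1 D])
    show "D * \<gamma> ^ i / k ^ (i + j) \<ge> 0" for i j using \<gamma> D by simp
  next
    fix f i j x assume x: "x \<in> tree_verts k"
    let ?N = "cousins k i j x"
    have wN: "w y > 0" if "y \<in> ?N" for y using that w[of y] by (simp add: cousins_def)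
    have wx: "w x > 0" using w[OF x] .
    let ?S = "\<Sum>y\<in>?N. \<bar>f y\<bar> powr q * \<sigma> y / real k ^ (i + j)"
    have S: "?S \<ge> 0" by (simp add: \<sigma>_def sum_nonneg)
    \<comment> \<open>Writing the values of \<open>f\<close> as \<open>w\<close> times a quotient
      makes \<open>w\<close> part of the Jensen weights; the remaining power
      \<open>w y * w y powr (- q)\<close> is exactly \<open>\<sigma> y\<close>.\<close>
    have "cousin_avg k f i j x powr q = (\<Sum>y\<in>?N. w y / real k ^ (i + j) * (\<bar>f y\<bar> / w y)) powr q"
      unfolding cousin_avg_def sum_divide_distrib
      by (intro arg_cong[where f = "\<lambda>z. z powr q"] sum.cong refl) (use wN in force)
    also have "\<dots> \<le> (\<Sum>y\<in>?N. w y / real k ^ (i + j)) powr (q - 1) *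
        (\<Sum>y\<in>?N. w y / real k ^ (i + j) * (\<bar>f y\<bar> / w y) powr q)"
      using q x wN by (intro powr_sum_le) (auto simp: less_imp_le)
    also have "(\<Sum>y\<in>?N. w y / real k ^ (i + j) * (\<bar>f y\<bar> / w y) powr q)
        = ?S"
      by (intro sum.cong refl)
        (use wN in \<open>auto simp: \<sigma>_def powr_divide powr_diff less_imp_le mult_ac\<close>)
    also have "(\<Sum>y\<in>?N. w y / real k ^ (i + j)) powr (q - 1) \<le> (E * \<alpha> ^ i * w x) powr (q - 1)"
      using q W[OF x, of i j] wN
      by (intro powr_mono2) (simp_all add: sum_divide_distrib sum_nonneg less_imp_le)
    also have "(E * \<alpha> ^ i * w x) powr (q - 1) = D * \<gamma> ^ i * w x powr (q - 1)"
      using E \<alpha> wx by (simp add: D_def \<gamma>_def powr_mult powr_powr mult.commute flip: powr_realpow)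
    finally have "cousin_avg k f i j x powr q \<le> D * \<gamma> ^ i * w x powr (q - 1) * ?S"
      using S by (simp add: mult_right_mono)
    then have "cousin_avg k f i j x powr q * \<sigma> x \<le> D * \<gamma> ^ i * w x powr (q - 1) * ?S * \<sigma> x"
      using \<sigma>[OF x] by (intro mult_right_mono) auto
    also have "\<dots> = D * \<gamma> ^ i * ?S *
        (w x powr (q - 1) * w x powr (1 - q))"
      by (simp add: \<sigma>_def)
    \<comment> \<open>The power of \<open>w x\<close> from the Jensen mass cancels against
      \<open>\<sigma> x\<close>, leaving a kernel that depends on neither vertex.\<close>
    also have "w x powr (q - 1) * w x powr (1 - q) = 1"
      using wx by (simp flip: powr_add)
    finally show "cousin_avg k f i j x powr q * \<sigma> x \<le>
        (\<Sum>y\<in>?N. D * \<gamma> ^ i / k ^ (i + j) * (\<bar>f y\<bar> powr q * \<sigma> y))"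
      by (simp add: sum_distrib_left mult_ac)
  next
    fix i j y assume y: "y \<in> tree_verts k"
    \<comment> \<open>There are at most \<open>k ^ i\<close> summands, which leaves
      \<open>1 / k ^ j\<close> of the normalisation.\<close>
    show "(\<Sum>x\<in>cousins k j i y. D * \<gamma> ^ i / k ^ (i + j)) \<le> D * \<gamma> ^ i * (1 / real k) ^ j"
      using k \<gamma> D by (simp add: card_cousins[OF y] power_add power_divide)
  qed
qed

theorem corollary2p2:
  fixes k :: nat and w :: "nat list \<Rightarrow> real"
  assumes "k \<ge> 2"
    and weight: "\<forall>x\<in>tree_verts k. w x > 0"
    and "\<exists>s>1. \<exists>C::real. C > 0 \<and>
           (\<forall>x\<in>tree_verts k. maximal_s k s w x \<le> ennreal C * ennreal (w x))"
  shows "\<forall>p::real. p > 1 \<longrightarrow>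
    (let \<sigma> = (\<lambda>x. w x powr (- 1 / (p - 1))); p' = p / (p - 1) in
      (\<exists>C::real. C > 0 \<and> (\<forall>f::nat list \<Rightarrow> real.
         Lq_norm k p w (maximal k f) \<le> ennreal C * Lq_norm k p w (\<lambda>x. ennreal \<bar>f x\<bar>))) \<and>
      (\<exists>C::real. C > 0 \<and> (\<forall>f::nat list \<Rightarrow> real.
         Lq_norm k p' \<sigma> (maximal k f) \<le> ennreal C * Lq_norm k p' \<sigma> (\<lambda>x. ennreal \<bar>f x\<bar>))))"
proof (intro allI impI)
  fix p :: real assume p: "p > 1"
  have w: "w x > 0" if "x \<in> tree_verts k" for x using weight that by blast
  from assms(3) obtain s C where s: "s > 1" and C: "C > (0::real)"
    and M: "\<And>x. x \<in> tree_verts k \<Longrightarrow> maximal_s k s w x \<le> ennreal C * ennreal (w x)"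
    by blast
  define \<alpha> where "\<alpha> = (1 / real k) powr ((s - 1) / s)"
  have \<alpha>: "0 < \<alpha>" "\<alpha> < 1"
    using assms(1) s powr_less_mono2[of "(s - 1) / s" "1 / real k" 1] by (auto simp: \<alpha>_def)
  have E: "4 powr (1 / s) * C > 0" using C by simp
  have W: "(\<Sum>y\<in>cousins k i j x. w y) / k ^ (i + j) \<le> 4 powr (1 / s) * C * \<alpha> ^ i * w x"
    if "x \<in> tree_verts k" for i j x
    unfolding \<alpha>_def by (rule cousin_weight_le[OF assms(1) w s C M that])
  \<comment> \<open>With \<open>q\<close> the conjugate exponent of \<open>p\<close>, the weight
    \<open>w powr (1 - q)\<close> of the dual bound is the required \<open>\<sigma>\<close>.\<close>
  have q: "p / (p - 1) > 1" "1 - p / (p - 1) = - 1 / (p - 1)"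
    using p by (simp_all add: field_simps)
  show "let \<sigma> = (\<lambda>x. w x powr (- 1 / (p - 1))); p' = p / (p - 1) in
      (\<exists>C::real. C > 0 \<and> (\<forall>f::nat list \<Rightarrow> real.
         Lq_norm k p w (maximal k f) \<le> ennreal C * Lq_norm k p w (\<lambda>x. ennreal \<bar>f x\<bar>))) \<and>
      (\<exists>C::real. C > 0 \<and> (\<forall>f::nat list \<Rightarrow> real.
         Lq_norm k p' \<sigma> (maximal k f) \<le> ennreal C * Lq_norm k p' \<sigma> (\<lambda>x. ennreal \<bar>f x\<bar>)))"
    unfolding Let_def
    using maximal_bounded_primal[OF assms(1) w p E \<alpha> W]
      maximal_bounded_dual[OF assms(1) w q(1) E \<alpha> W, unfolded q(2)]
    by (intro conjI)
qed

end
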